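(* Let $a,b,c\geq 1$ be integers and let $x$ be a complex number with $x^3\neq 1$. Let $n\geq 0$, $p\geq 0$, $q\geq 0$ be integers. Then $$\mathcal{Z}_{n+p}(x)\mathcal{Z}_{n+q}(x)-\mathcal{Z}_{n}(x)\mathcal{Z}_{n+p+q}(x)=(x^{2}+x+1)\,\mathcal{A}_{p}\mathcal{A}_{q}\,\Phi_{1}\Phi_{2},$$ and $$\mathcal{BJ}_{n+p}^{(a,b,c)}(x)\,\mathcal{BJ}_{n+q}^{(a,b,c)}(x)-\mathcal{BJ}_{n}^{(a,b,c)}(x)\,\mathcal{BJ}_{n+p+q}^{(a,b,c)}(x)=\frac{1}{(x^{2}+x+1)^{2}}\Big( (x^{2}+x+1)\mathcal{A}_{p}\mathcal{A}_{q}\Phi_{1}\Phi_{2}+ x^{n+1}\Theta \left(\mathcal{B}_{n+q}(p)-x^{q}\mathcal{B}_{n}(p)\right)\Big).$$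
   Context: The third-order Jacobsthal polynomials are defined, for $x^3\neq 1$, by $\mathcal{J}_{0}^{(3)}(x)=0$, $\mathcal{J}_{1}^{(3)}(x)=1$, $\mathcal{J}_{2}^{(3)}(x)=x-1$ and $\mathcal{J}_{n+3}^{(3)}(x)=(x-1)\mathcal{J}_{n+2}^{(3)}(x)+(x-1)\mathcal{J}_{n+1}^{(3)}(x)+x\mathcal{J}_{n}^{(3)}(x)$ for $n\geq 0$. Bihyperbolic numbers are the elements $a_0+a_1j_1+a_2j_2+a_3j_3$ with multiplication determined by $j_1^2=j_2^2=j_3^2=1$, $j_1j_2=j_2j_1=j_3$, $j_1j_3=j_3j_1=j_2$, $j_2j_3=j_3j_2=j_1$; this gives a commutative associative unital algebra with basis $1,j_1,j_2,j_3$ (over $\mathbb{R}$ for bihyperbolic numbers proper). All identities are read in its complexification, i.e. coefficients $a_i$ are allowed to be complex. For integers $a,b,c\geq1$ and $n\geq 0$, the generalized bihyperbolic third-order Jacobsthal polynomial is $\mathcal{BJ}_{n}^{(a,b,c)}(x)=\mathcal{J}_{n}^{(3)}(x)+\mathcal{J}_{n+a}^{(3)}(x)j_{1}+\mathcal{J}_{n+b}^{(3)}(x)j_{2}+\mathcal{J}_{n+c}^{(3)}(x)j_{3}$. Let $\omega_1,\omega_2$ be the two (complex) roots of $\lambda^2+\lambda+1=0$. Put $\Theta=1+x^{a}j_{1}+x^{b}j_{2}+x^{c}j_{3}$, $\Phi_{1}=1+\omega_{1}^{a}j_{1}+\omega_{1}^{b}j_{2}+\omega_{1}^{c}j_{3}$,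 $\Phi_{2}=1+\omega_{2}^{a}j_{1}+\omega_{2}^{b}j_{2}+\omega_{2}^{c}j_{3}$, $\mathcal{Z}_{n}(x)=\frac{1}{\omega_{1}-\omega_{2}}\left((\omega_{1}x-1)\omega_{1}^{n}\Phi_{1}-(\omega_{2}x-1)\omega_{2}^{n}\Phi_{2}\right)$, $\mathcal{A}_{n}=\frac{\omega_{1}^{n}-\omega_{2}^{n}}{\omega_{1}-\omega_{2}}$ and $\mathcal{B}_{n}(p)=\mathcal{Z}_{n+p}(x)-x^{p}\mathcal{Z}_{n}(x)$. *)

theory Defs
  imports Complex_Main
begin

text \<open>
  Bihyperbolic numbers \<open>a0 + a1 j1 + a2 j2 + a3 j3\<close> with coefficients in a commutative ring:
  \<open>real bihyp\<close> are the bihyperbolic numbers proper, \<open>complex bihyp\<close> is their complexification.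
\<close>

datatype 'a bihyp = Bihyp (bh0: 'a) (bh1: 'a) (bh2: 'a) (bh3: 'a)

instantiation bihyp :: (comm_ring_1) comm_ring_1
begin

definition zero_bihyp :: "'a bihyp" where
  "0 = Bihyp 0 0 0 0"

definition one_bihyp :: "'a bihyp" where
  "1 = Bihyp 1 0 0 0"

definition plus_bihyp :: "'a bihyp \<Rightarrow> 'a bihyp \<Rightarrow> 'a bihyp" where
  "u + v = Bihyp (bh0 u + bh0 v) (bh1 u + bh1 v) (bh2 u + bh2 v) (bh3 u + bh3 v)"

definition minus_bihyp :: "'a bihyp \<Rightarrow> 'a bihyp \<Rightarrow> 'a bihyp" where
  "u - v = Bihyp (bh0 u - bh0 v) (bh1 u - bh1 v) (bh2 u - bh2 v) (bh3 u - bh3 v)"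

definition uminus_bihyp :: "'a bihyp \<Rightarrow> 'a bihyp" where
  "- u = Bihyp (- bh0 u) (- bh1 u) (- bh2 u) (- bh3 u)"

text \<open>
  The bilinear extension of the multiplication table of \<open>1, j1, j2, j3\<close>;
  the table itself is lemma \<open>bihyp_table\<close>.
\<close>

definition times_bihyp :: "'a bihyp \<Rightarrow> 'a bihyp \<Rightarrow> 'a bihyp" where
  "u * v = Bihyp
     (bh0 u * bh0 v + bh1 u * bh1 v + bh2 u * bh2 v + bh3 u * bh3 v)
     (bh0 u * bh1 v + bh1 u * bh0 v + bh2 u * bh3 v + bh3 u * bh2 v)
     (bh0 u * bh2 v + bh2 u * bh0 v + bh1 u * bh3 v + bh3 u * bh1 v)
     (bh0 u * bh3 v + bh3 u * bh0 v + bh1 u * bh2 v + bh2 u * bh1 v)"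

instance
  by standard
    (simp_all add: zero_bihyp_def one_bihyp_def plus_bihyp_def minus_bihyp_def
      uminus_bihyp_def times_bihyp_def algebra_simps)

end

definition scale_bihyp :: "'a::comm_ring_1 \<Rightarrow> 'a bihyp \<Rightarrow> 'a bihyp" (infixr "*\<^sub>b" 75) where
  "r *\<^sub>b u = Bihyp (r * bh0 u) (r * bh1 u) (r * bh2 u) (r * bh3 u)"

definition j1 :: "'a::comm_ring_1 bihyp" where "j1 = Bihyp 0 1 0 0"
definition j2 :: "'a::comm_ring_1 bihyp" where "j2 = Bihyp 0 0 1 0"
definition j3 :: "'a::comm_ring_1 bihyp" where "j3 = Bihyp 0 0 0 1"

lemmas bihyp_defs = zero_bihyp_def one_bihyp_def plus_bihyp_def minus_bihyp_def
  uminus_bihyp_def times_bihyp_def scale_bihyp_def j1_def j2_def j3_def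

lemma bihyp_table:
  "j1 * j1 = 1" "j2 * j2 = 1" "j3 * j3 = 1"
  "j1 * j2 = j3" "j2 * j1 = j3"
  "j1 * j3 = j2" "j3 * j1 = j2"
  "j2 * j3 = j1" "j3 * j2 = j1"
  by (simp_all add: bihyp_defs)

lemma Bihyp_eq_basis:
  "Bihyp r0 r1 r2 r3 = r0 *\<^sub>b 1 + r1 *\<^sub>b j1 + r2 *\<^sub>b j2 + r3 *\<^sub>b j3"
  by (simp add: bihyp_defs)

lemma module_scale_bihyp: "module (scale_bihyp :: 'a::comm_ring_1 \<Rightarrow> _)"
  by standard (simp_all add: bihyp_defs algebra_simps)

lemma scale_bihyp_mult:
  "(r *\<^sub>b u) * v = r *\<^sub>b (u * v)" "u * (r *\<^sub>b v) = r *\<^sub>b (u * v)"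
  by (simp_all add: bihyp_defs algebra_simps)

fun jacobsthal3 :: "'a::comm_ring_1 \<Rightarrow> nat \<Rightarrow> 'a" where
  "jacobsthal3 x 0 = 0"
| "jacobsthal3 x (Suc 0) = 1"
| "jacobsthal3 x (Suc (Suc 0)) = x - 1"
| "jacobsthal3 x (Suc (Suc (Suc n))) =
     (x - 1) * jacobsthal3 x (Suc (Suc n)) + (x - 1) * jacobsthal3 x (Suc n) + x * jacobsthal3 x n"

definition BJ :: "nat \<Rightarrow> nat \<Rightarrow> nat \<Rightarrow> 'a::comm_ring_1 \<Rightarrow> nat \<Rightarrow> 'a bihyp" where
  "BJ a b c x n = Bihyp (jacobsthal3 x n) (jacobsthal3 x (n + a))
     (jacobsthal3 x (n + b)) (jacobsthal3 x (n + c))"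

text \<open>
  \<open>\<Theta>\<close>, \<open>\<Phi>\<^sub>1\<close> and \<open>\<Phi>\<^sub>2\<close> are the same expression evaluated at \<open>x\<close>, \<open>\<omega>\<^sub>1\<close> and \<open>\<omega>\<^sub>2\<close> respectively.
\<close>

definition power_bihyp :: "nat \<Rightarrow> nat \<Rightarrow> nat \<Rightarrow> 'a::comm_ring_1 \<Rightarrow> 'a bihyp" where
  "power_bihyp a b c t = Bihyp 1 (t ^ a) (t ^ b) (t ^ c)"

text \<open>
  In the following, \<open>\<omega>1\<close> and \<open>\<omega>2\<close> stand for the two roots of \<open>\<lambda>\<^sup>2 + \<lambda> + 1\<close>, in either order.
\<close>

definition Z_seq ::
  "nat \<Rightarrow> nat \<Rightarrow> nat \<Rightarrow> complex \<Rightarrow> complex \<Rightarrow> complex \<Rightarrow> nat \<Rightarrow> complex bihyp" where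
  "Z_seq a b c \<omega>1 \<omega>2 x n =
     (1 / (\<omega>1 - \<omega>2)) *\<^sub>b
       (((\<omega>1 * x - 1) * \<omega>1 ^ n) *\<^sub>b power_bihyp a b c \<omega>1
        - ((\<omega>2 * x - 1) * \<omega>2 ^ n) *\<^sub>b power_bihyp a b c \<omega>2)"

definition A_seq :: "complex \<Rightarrow> complex \<Rightarrow> nat \<Rightarrow> complex" where
  "A_seq \<omega>1 \<omega>2 n = (\<omega>1 ^ n - \<omega>2 ^ n) / (\<omega>1 - \<omega>2)"

definition B_seq ::
  "nat \<Rightarrow> nat \<Rightarrow> nat \<Rightarrow> complex \<Rightarrow> complex \<Rightarrow> complex \<Rightarrow> nat \<Rightarrow> nat \<Rightarrow> complex bihyp" where
  "B_seq a b c \<omega>1 \<omega>2 x n p =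
     Z_seq a b c \<omega>1 \<omega>2 x (n + p) - (x ^ p) *\<^sub>b Z_seq a b c \<omega>1 \<omega>2 x n"

end

theory Submission
  imports Defs
begin

text \<open>
  The characteristic polynomial of the recurrence is
  \<open>t^3 - (x - 1) t^2 - (x - 1) t - x = (t - x) (t^2 + t + 1)\<close>, so
  \<open>jacobsthal3 x\<close> is a combination of the powers of \<open>x\<close>, \<open>\<omega>1\<close> and \<open>\<omega>2\<close>. Collecting the four
  shifts \<open>0, a, b, c\<close> into one bihyperbolic number turns this into
  \<open>D BJ n = x^(n + 1) \<Theta> - Z n\<close>, where \<open>D = x^2 + x + 1\<close> is nonzero because \<open>x^3 \<noteq> 1\<close>
  (lemma \<open>BJ_binet\<close>).

  The sequence \<open>Z\<close> itself combines only the powers of \<open>\<omega>1\<close> and \<open>\<omega>2\<close>. In the product difference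
  the squares of \<open>\<Phi>1\<close> and \<open>\<Phi>2\<close> cancel, and the cross terms factor as in Vajda's
  identity for Fibonacci numbers (lemma \<open>vajda_two_term\<close>). The factor \<open>(\<omega>1 \<omega>2)^n\<close> is \<open>1\<close>, and
  \<open>(\<omega>1 x - 1) (\<omega>2 x - 1)\<close> is \<open>D\<close>; this is the first identity.

  For the second one, substitute the Binet formula. The terms in \<open>\<Theta>^2\<close> cancel, since
  \<open>(n + p) + (n + q) = n + (n + p + q)\<close>; the terms without \<open>\<Theta>\<close> are given by the first identity;
  and the four mixed terms regroup into the double difference of \<open>Z\<close> that the sequence \<open>B\<close>
  expresses.

  Since scalars act through the ring embedding \<open>r \<mapsto> r 1\<close>, both product
  differences are computed by identities of commutative rings.
  Only the Binet formula is checked coordinate by coordinate.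
\<close>

section \<open>Scalars inside the bihyperbolic numbers\<close>

definition bihyp_of :: "'a::comm_ring_1 \<Rightarrow> 'a bihyp" where
  "bihyp_of r = r *\<^sub>b 1"

lemma scale_bihyp_eq_times: "r *\<^sub>b u = bihyp_of r * u"
  by (simp add: bihyp_of_def bihyp_defs)

lemma bihyp_of_one [simp]: "bihyp_of 1 = 1"
  by (simp add: bihyp_of_def bihyp_defs)

lemma bihyp_of_diff: "bihyp_of (r - s) = bihyp_of r - bihyp_of s"
  by (simp add: bihyp_of_def bihyp_defs)

lemma bihyp_of_mult: "bihyp_of (r * s) = bihyp_of r * bihyp_of s"
  by (simp add: bihyp_of_def bihyp_defs)

lemma bihyp_of_power: "bihyp_of (r ^ n) = bihyp_of r ^ n"
  by (induction n) (simp_all add: bihyp_of_mult)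

section \<open>The two primitive cube roots of unity\<close>

lemma roots_sum_product:
  fixes \<omega>1 \<omega>2 :: "'a::idom"
  assumes "\<omega>1\<^sup>2 + \<omega>1 + 1 = 0" "\<omega>2\<^sup>2 + \<omega>2 + 1 = 0" "\<omega>1 \<noteq> \<omega>2"
  shows "\<omega>1 + \<omega>2 = -1" "\<omega>1 * \<omega>2 = 1"
proof -
  have "(\<omega>1 - \<omega>2) * (\<omega>1 + \<omega>2 + 1) = (\<omega>1\<^sup>2 + \<omega>1 + 1) - (\<omega>2\<^sup>2 + \<omega>2 + 1)"
    by (simp add: algebra_simps power2_eq_square)
  with assms have sum0: "\<omega>1 + \<omega>2 + 1 = 0"
    by simp
  then show "\<omega>1 + \<omega>2 = -1"
    by (simp add: eq_neg_iff_add_eq_0)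
  have "\<omega>1 * \<omega>2 - 1 = \<omega>1 * (\<omega>1 + \<omega>2 + 1) - (\<omega>1\<^sup>2 + \<omega>1 + 1)"
    by (simp add: algebra_simps power2_eq_square)
  with assms sum0 show "\<omega>1 * \<omega>2 = 1"
    by simp
qed

section \<open>Binet formulas\<close>

lemma char_root_recurrence:
  fixes t x :: "'a::comm_ring_1"
  assumes "(t - x) * (t\<^sup>2 + t + 1) = 0"
  shows "t ^ Suc (Suc (Suc n)) = (x - 1) * t ^ Suc (Suc n) + (x - 1) * t ^ Suc n + x * t ^ n"
proof -
  have "t ^ Suc (Suc (Suc n)) - ((x - 1) * t ^ Suc (Suc n) + (x - 1) * t ^ Suc n + x * t ^ n)
      = t ^ n * ((t - x) * (t\<^sup>2 + t + 1))"
    by (simp add: algebra_simps power2_eq_square)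
  with assms show ?thesis
    by simp
qed

text \<open>
  Both sides satisfy the same third-order recurrence, so only the values at \<open>0, 1, 2\<close> have to be
  compared. Clearing the denominator \<open>\<omega>1 - \<omega>2\<close> keeps the induction inside a ring.
\<close>
lemma jacobsthal3_binet_cleared:
  fixes x \<omega>1 \<omega>2 :: "'a::idom"
  assumes roots: "\<omega>1\<^sup>2 + \<omega>1 + 1 = 0" "\<omega>2\<^sup>2 + \<omega>2 + 1 = 0"
  shows "(\<omega>1 - \<omega>2) * (x\<^sup>2 + x + 1) * jacobsthal3 x n
    = (\<omega>1 - \<omega>2) * x ^ (n + 1) - ((\<omega>1 * x - 1) * \<omega>1 ^ n - (\<omega>2 * x - 1) * \<omega>2 ^ n)"
proof (induction x n rule: jacobsthal3.induct)
  case (1 x)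
  show ?case
    by (simp add: algebra_simps)
next
  case (2 x)
  show ?case
    using roots by simp algebra
next
  case (3 x)
  show ?case
    using roots by (simp add: power2_eq_square) algebra
next
  case (4 x n)
  let ?c = "(\<omega>1 - \<omega>2) * (x\<^sup>2 + x + 1)"
  have x: "x ^ Suc (Suc (Suc m)) = (x - 1) * x ^ Suc (Suc m) + (x - 1) * x ^ Suc m + x * x ^ m" for m
    by (rule char_root_recurrence) simp
  have w: "\<omega> ^ Suc (Suc (Suc n))
      = (x - 1) * \<omega> ^ Suc (Suc n) + (x - 1) * \<omega> ^ Suc n + x * \<omega> ^ n"
    if "\<omega>\<^sup>2 + \<omega> + 1 = 0" for \<omega>
    by (rule char_root_recurrence) (simp add: that)
  have "?c * jacobsthal3 x (Suc (Suc (Suc n)))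
      = (x - 1) * (?c * jacobsthal3 x (Suc (Suc n))) + (x - 1) * (?c * jacobsthal3 x (Suc n))
        + x * (?c * jacobsthal3 x n)"
    by (simp add: algebra_simps)
  also have "\<dots> = (\<omega>1 - \<omega>2) * x ^ Suc (Suc (Suc (Suc n)))
      - ((\<omega>1 * x - 1) * \<omega>1 ^ Suc (Suc (Suc n)) - (\<omega>2 * x - 1) * \<omega>2 ^ Suc (Suc (Suc n)))"
    unfolding 4 x[of "Suc n"] w[OF roots(1)] w[OF roots(2)] Suc_eq_plus1[symmetric]
    by algebra
  finally show ?case
    by simp
qed

lemma BJ_binet:
  fixes x \<omega>1 \<omega>2 :: complex
  assumes roots: "\<omega>1\<^sup>2 + \<omega>1 + 1 = 0" "\<omega>2\<^sup>2 + \<omega>2 + 1 = 0" and ne: "\<omega>1 \<noteq> \<omega>2"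
  shows "(x\<^sup>2 + x + 1) *\<^sub>b BJ a b c x n
    = x ^ (n + 1) *\<^sub>b power_bihyp a b c x - Z_seq a b c \<omega>1 \<omega>2 x n"
proof -
  have "(x\<^sup>2 + x + 1) * jacobsthal3 x m
      = x ^ (m + 1) - 1 / (\<omega>1 - \<omega>2) * ((\<omega>1 * x - 1) * \<omega>1 ^ m - (\<omega>2 * x - 1) * \<omega>2 ^ m)" for m
    using jacobsthal3_binet_cleared[OF roots, of x m] ne by (simp add: field_simps)
  from this[of n] this[of "n + a"] this[of "n + b"] this[of "n + c"] show ?thesis
    by (simp add: BJ_def Z_seq_def power_bihyp_def scale_bihyp_def minus_bihyp_def power_add mult_ac)
qed

section \<open>Product differences\<close>

text \<open>
  The pure terms \<open>s^2\<close> and \<open>t^2\<close> occur with equal total exponents in both products and cancel; what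
  remains is \<open>s t (v w)^n\<close> times \<open>v^(p + q) + w^(p + q) - v^p w^q - w^p v^q\<close>, which factors.
\<close>
lemma vajda_two_term:
  fixes s t v w :: "'a::comm_ring_1"
  shows "(s * v ^ (n + p) - t * w ^ (n + p)) * (s * v ^ (n + q) - t * w ^ (n + q))
      - (s * v ^ n - t * w ^ n) * (s * v ^ (n + p + q) - t * w ^ (n + p + q))
    = s * t * (v * w) ^ n * ((v ^ p - w ^ p) * (v ^ q - w ^ q))"
  by (simp add: power_add power_mult_distrib algebra_simps)

lemma Z_seq_eq_two_term:
  "Z_seq a b c \<omega>1 \<omega>2 x m = bihyp_of (1 / (\<omega>1 - \<omega>2)) *
     (bihyp_of (\<omega>1 * x - 1) * power_bihyp a b c \<omega>1 * bihyp_of \<omega>1 ^ m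
      - bihyp_of (\<omega>2 * x - 1) * power_bihyp a b c \<omega>2 * bihyp_of \<omega>2 ^ m)"
  by (simp add: Z_seq_def scale_bihyp_eq_times bihyp_of_mult bihyp_of_power mult_ac)

text \<open>
  Vajda's factorization applies with \<open>v = \<omega>1\<close>, \<open>w = \<omega>2\<close>. The result does not depend on \<open>n\<close> because
  \<open>\<omega>1 \<omega>2 = 1\<close>, and \<open>x^2 + x + 1\<close> appears as the product of the two weights \<open>\<omega>1 x - 1\<close> and
  \<open>\<omega>2 x - 1\<close>.
\<close>
lemma Z_seq_vajda:
  fixes x \<omega>1 \<omega>2 :: complex
  assumes roots: "\<omega>1\<^sup>2 + \<omega>1 + 1 = 0" "\<omega>2\<^sup>2 + \<omega>2 + 1 = 0" and ne: "\<omega>1 \<noteq> \<omega>2"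
  shows "Z_seq a b c \<omega>1 \<omega>2 x (n + p) * Z_seq a b c \<omega>1 \<omega>2 x (n + q)
      - Z_seq a b c \<omega>1 \<omega>2 x n * Z_seq a b c \<omega>1 \<omega>2 x (n + p + q)
    = ((x\<^sup>2 + x + 1) * A_seq \<omega>1 \<omega>2 p * A_seq \<omega>1 \<omega>2 q) *\<^sub>b
        (power_bihyp a b c \<omega>1 * power_bihyp a b c \<omega>2)"
proof -
  define k where "k = 1 / (\<omega>1 - \<omega>2)"
  define s where "s = bihyp_of (\<omega>1 * x - 1) * power_bihyp a b c \<omega>1"
  define t where "t = bihyp_of (\<omega>2 * x - 1) * power_bihyp a b c \<omega>2"
  define v where "v = bihyp_of \<omega>1"
  define w where "w = bihyp_of \<omega>2"
  have Z: "Z_seq a b c \<omega>1 \<omega>2 x m = bihyp_of k * (s * v ^ m - t * w ^ m)" for m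
    by (simp add: Z_seq_eq_two_term k_def s_def t_def v_def w_def)
  have "(\<omega>1 * x - 1) * (\<omega>2 * x - 1) = \<omega>1 * \<omega>2 * x\<^sup>2 - (\<omega>1 + \<omega>2) * x + 1"
    by (simp add: algebra_simps power2_eq_square)
  then have norm: "(\<omega>1 * x - 1) * (\<omega>2 * x - 1) = x\<^sup>2 + x + 1"
    by (simp add: roots_sum_product[OF roots ne])
  have st: "s * t = bihyp_of (x\<^sup>2 + x + 1) * (power_bihyp a b c \<omega>1 * power_bihyp a b c \<omega>2)"
    unfolding s_def t_def norm[symmetric] by (simp add: bihyp_of_mult mult_ac)
  have vw: "v * w = 1"
    by (simp add: v_def w_def bihyp_of_mult[symmetric] roots_sum_product[OF roots ne])
  have A: "bihyp_of (A_seq \<omega>1 \<omega>2 m) = bihyp_of k * (v ^ m - w ^ m)" for m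
  proof -
    have "A_seq \<omega>1 \<omega>2 m = k * (\<omega>1 ^ m - \<omega>2 ^ m)"
      by (simp add: A_seq_def k_def)
    then show ?thesis
      by (simp add: v_def w_def bihyp_of_mult bihyp_of_diff bihyp_of_power)
  qed
  have "Z_seq a b c \<omega>1 \<omega>2 x (n + p) * Z_seq a b c \<omega>1 \<omega>2 x (n + q)
      - Z_seq a b c \<omega>1 \<omega>2 x n * Z_seq a b c \<omega>1 \<omega>2 x (n + p + q)
    = bihyp_of k * bihyp_of k *
       ((s * v ^ (n + p) - t * w ^ (n + p)) * (s * v ^ (n + q) - t * w ^ (n + q))
        - (s * v ^ n - t * w ^ n) * (s * v ^ (n + p + q) - t * w ^ (n + p + q)))"
    unfolding Z by (simp add: algebra_simps)
  also have "\<dots> = s * t * bihyp_of (A_seq \<omega>1 \<omega>2 p) * bihyp_of (A_seq \<omega>1 \<omega>2 q)"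
    unfolding vajda_two_term vw A by (simp add: mult_ac)
  finally show ?thesis
    by (simp add: st scale_bihyp_eq_times bihyp_of_mult mult_ac)
qed

text \<open>
  Here \<open>u\<close> plays the role of \<open>D BJ\<close>. The geometric sequence \<open>g y^m\<close> has
  vanishing product difference of its own, so it contributes only through its interaction with \<open>z\<close>.
\<close>
lemma product_difference_geometric_minus:
  fixes u z :: "nat \<Rightarrow> 'a::comm_ring_1"
  assumes "\<And>m. u m = g * y ^ m - z m"
  shows "u (n + p) * u (n + q) - u n * u (n + p + q)
    = z (n + p) * z (n + q) - z n * z (n + p + q)
      + g * y ^ n * ((z (n + q + p) - y ^ p * z (n + q)) - y ^ q * (z (n + p) - y ^ p * z n))"
  by (simp add: assms power_add algebra_simps)

theorem theorem2p6:
  fixes a b c n p q :: nat and x \<omega>1 \<omega>2 :: complex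
  assumes "a \<ge> 1" "b \<ge> 1" "c \<ge> 1"
    and "x ^ 3 \<noteq> 1"
    and "\<omega>1\<^sup>2 + \<omega>1 + 1 = 0" "\<omega>2\<^sup>2 + \<omega>2 + 1 = 0" "\<omega>1 \<noteq> \<omega>2"
  shows
    "Z_seq a b c \<omega>1 \<omega>2 x (n + p) * Z_seq a b c \<omega>1 \<omega>2 x (n + q)
       - Z_seq a b c \<omega>1 \<omega>2 x n * Z_seq a b c \<omega>1 \<omega>2 x (n + p + q)
     = ((x\<^sup>2 + x + 1) * A_seq \<omega>1 \<omega>2 p * A_seq \<omega>1 \<omega>2 q) *\<^sub>b
         (power_bihyp a b c \<omega>1 * power_bihyp a b c \<omega>2)
     \<and>
     BJ a b c x (n + p) * BJ a b c x (n + q) - BJ a b c x n * BJ a b c x (n + p + q)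
     = (1 / (x\<^sup>2 + x + 1)\<^sup>2) *\<^sub>b
         (((x\<^sup>2 + x + 1) * A_seq \<omega>1 \<omega>2 p * A_seq \<omega>1 \<omega>2 q) *\<^sub>b
            (power_bihyp a b c \<omega>1 * power_bihyp a b c \<omega>2)
          + (x ^ (n + 1)) *\<^sub>b
              (power_bihyp a b c x *
                 (B_seq a b c \<omega>1 \<omega>2 x (n + q) p - (x ^ q) *\<^sub>b B_seq a b c \<omega>1 \<omega>2 x n p)))"
proof -
  note roots = assms(5,6) and ne = assms(7)
  define D where "D = x\<^sup>2 + x + 1"
  define U where "U m = D *\<^sub>b BJ a b c x m" for m
  have "x ^ 3 - 1 = (x - 1) * D"
    by (simp add: D_def algebra_simps power2_eq_square power3_eq_cube)
  with \<open>x ^ 3 \<noteq> 1\<close> have "D \<noteq> 0"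
    by auto
  then have BJ: "BJ a b c x m = (1 / D) *\<^sub>b U m" for m
    by (simp add: U_def scale_bihyp_def)
  have U: "U m = bihyp_of x * power_bihyp a b c x * bihyp_of x ^ m - Z_seq a b c \<omega>1 \<omega>2 x m" for m
    unfolding U_def D_def BJ_binet[OF roots ne]
    by (simp add: scale_bihyp_eq_times bihyp_of_mult bihyp_of_power mult_ac)
  have "BJ a b c x (n + p) * BJ a b c x (n + q) - BJ a b c x n * BJ a b c x (n + p + q)
      = (1 / D\<^sup>2) *\<^sub>b (U (n + p) * U (n + q) - U n * U (n + p + q))"
  proof -
    have "bihyp_of (1 / D\<^sup>2) = bihyp_of (1 / D) * bihyp_of (1 / D)"
      by (simp add: bihyp_of_mult[symmetric] power2_eq_square)
    then show ?thesis
      by (simp add: BJ scale_bihyp_eq_times algebra_simps)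
  qed
  also note product_difference_geometric_minus[of U, OF U]
  also note Z_seq_vajda[OF roots ne]
  finally show ?thesis
    using Z_seq_vajda[OF roots ne, of a b c x n p q]
    by (simp add: D_def B_seq_def scale_bihyp_eq_times bihyp_of_mult bihyp_of_power mult_ac)
qed

end
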